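(* Let $\mathcal{S}=((X,d),(f_i)_{i\in I})$ be an iterated function system consisting of convex contractions on a nonempty complete metric space $(X,d)$, with $I$ finite and nonempty. Let $A$ be its attractor and, for $\omega\in\Lambda(I)$, let $a_\omega$ be the associated point (both as defined in the context). Then the function $\pi:\Lambda(I)\to A$ defined by $\pi(\omega)=a_\omega$ for every $\omega\in\Lambda(I)$ (called the canonical projection from $\Lambda(I)$ to $A$) has the following properties: 1) $\pi$ is continuous (with respect to the metric $d_\Lambda$ on $\Lambda(I)$ and the metric $d$ on $A$); 2) $\pi$ is onto; 3) $\pi\circ F_i=f_i\circ\pi$ for every $i\in I$.
   Context: $\mathcal{K}(X)$ is the set of nonempty compact subsets of $X$. For nonempty $A,B\subseteq X$, the Hausdorff-Pompeiu distance is $h(A,B)=\max(d(A,B),d(B,A))$, where $d(A,B)=\sup_{x\in A}\inf_{y\in B}d(x,y)$. An iterated function system consisting of convex contractions on a complete metric space $(X,d)$, denoted $\mathcal{S}=((X,d),(f_i)_{i\in I})$, is given by a finite family of continuous functions $f_i:X\to X$, $i\in I$, such that for every $i,j\in I$ there exist $a_{ij},b_{ij},c_{ij}\in[0,\infty)$ with the following two properties: ($\alpha$) $d_{ij}:=a_{ij}+b_{ij}+c_{ij}$ satisfies $\max_{i,j\in I}d_{ij}=:d<1$; ($\beta$) $d((f_i\circ f_j)(x),(f_i\circ f_j)(y))\le a_{ij}\,d(x,y)+b_{ij}\,d(f_i(x),f_i(y))+c_{ij}\,d(f_j(x),f_j(y))$ for every $i,j\in I$ and all $x,y\in X$. The associated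 function $F_{\mathcal{S}}:\mathcal{K}(X)\to\mathcal{K}(X)$ is $F_{\mathcal{S}}(B)=\bigcup_{i\in I}f_i(B)$, and $F_{\mathcal{S}}^{[n]}$ denotes its $n$-fold composition with itself. $\Lambda(I)=I^{\{1,2,3,\dots\}}$ is the set of infinite words $\omega=\omega_1\omega_2\omega_3\dots$ with letters in $I$. It is equipped with the metric $d_\Lambda$ given by $d_\Lambda(\alpha,\alpha)=0$ and, for $\alpha\ne\beta$, $d_\Lambda(\alpha,\beta)=2^{-n}$, where $n$ is the index such that $\alpha_k=\beta_k$ for $k<n$ and $\alpha_n\ne\beta_n$. For $i\in I$, $F_i:\Lambda(I)\to\Lambda(I)$ is $F_i(\alpha)=i\alpha$ (the word with first letter $i$ followed by $\alpha$). For $n\ge1$, $[\omega]_n=\omega_1\omega_2\dots\omega_n$, and $f_{\omega_1\dots\omega_n}=f_{\omega_1}\circ\dots\circ f_{\omega_n}$. The attractor $A$ is the unique element of $\mathcal{K}(X)$ such that $\lim_{n\to\infty}h(F_{\mathcal{S}}^{[n]}(B),A)=0$ for every $B\in\mathcal{K}(X)$. For $\omega\in\Lambda(I)$, $a_\omega$ is the unique point of $X$ such that $\lim_{n\to\infty}h(f_{[\omega]_n}(B),\{a_\omega\})=0$ for every $B\in\mathcal{K}(X)$. The existence of $A$ and of the points $a_\omega$, and the facts that $A=\overline{\{a_\omega\mid\omega\in\Lambda(I)\}}$ and that $A$ is the unique fixed point of $F_{\mathcal{S}}$ in $\mathcal{K}(X)$, are established in an earlier theorem of the paper. *)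

theory Defs
  imports "HOL-Analysis.Analysis" "HOL-Library.Stream"
begin

definition nonempty_compacts :: "'a::metric_space set set" where
  "nonempty_compacts = {B. compact B \<and> B \<noteq> {}}"

text \<open>The distances are extended-real valued, since the supremum may be infinite for
  unbounded sets.\<close>

definition set_excess :: "'a::metric_space set \<Rightarrow> 'a set \<Rightarrow> ereal" where
  "set_excess A B = (SUP x\<in>A. INF y\<in>B. ereal (dist x y))"

definition hausdorff_pompeiu :: "'a::metric_space set \<Rightarrow> 'a set \<Rightarrow> ereal" where
  "hausdorff_pompeiu A B = max (set_excess A B) (set_excess B A)"

definition convex_contraction_IFS :: "'i set \<Rightarrow> ('i \<Rightarrow> 'a::metric_space \<Rightarrow> 'a) \<Rightarrow> bool" where
  "convex_contraction_IFS I f \<longleftrightarrow>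
     finite I \<and> I \<noteq> {} \<and> (\<forall>i\<in>I. continuous_on UNIV (f i)) \<and>
     (\<exists>a b c :: 'i \<Rightarrow> 'i \<Rightarrow> real.
        (\<forall>i\<in>I. \<forall>j\<in>I. 0 \<le> a i j \<and> 0 \<le> b i j \<and> 0 \<le> c i j) \<and>
        Max ((\<lambda>(i, j). a i j + b i j + c i j) ` (I \<times> I)) < 1 \<and>
        (\<forall>i\<in>I. \<forall>j\<in>I. \<forall>x y.
           dist ((f i \<circ> f j) x) ((f i \<circ> f j) y)
             \<le> a i j * dist x y + b i j * dist (f i x) (f i y) + c i j * dist (f j x) (f j y)))"

definition IFS_operator :: "'i set \<Rightarrow> ('i \<Rightarrow> 'a \<Rightarrow> 'a) \<Rightarrow> 'a set \<Rightarrow> 'a set" where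
  "IFS_operator I f B = (\<Union>i\<in>I. f i ` B)"

definition attractor :: "'i set \<Rightarrow> ('i \<Rightarrow> 'a::metric_space \<Rightarrow> 'a) \<Rightarrow> 'a set" where
  "attractor I f = (THE A. A \<in> nonempty_compacts \<and>
     (\<forall>B\<in>nonempty_compacts. (\<lambda>n. hausdorff_pompeiu ((IFS_operator I f ^^ n) B) A) \<longlonglongrightarrow> 0))"

text \<open>Infinite words over \<open>I\<close> are the elements of \<open>streams I\<close>; prefixing the letter \<open>i\<close> is
  \<open>(##) i\<close>, and the prefix of length \<open>n\<close> is \<open>stake n\<close>.
  Stream positions start at 0, word positions at 1, whence the \<open>Suc\<close> in the exponent.\<close>

definition word_dist :: "'i stream \<Rightarrow> 'i stream \<Rightarrow> real" where
  "word_dist \<alpha> \<beta> = (if \<alpha> = \<beta> then 0 else (1 / 2) ^ Suc (LEAST n. \<alpha> !! n \<noteq> \<beta> !! n))"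

text \<open>The composition \<open>f w1 \<circ> \<dots> \<circ> f wn\<close> along a finite word.\<close>

definition word_map :: "('i \<Rightarrow> 'a \<Rightarrow> 'a) \<Rightarrow> 'i list \<Rightarrow> 'a \<Rightarrow> 'a" where
  "word_map f w = foldr (\<lambda>i g. f i \<circ> g) w id"

definition canonical_projection :: "('i \<Rightarrow> 'a::metric_space \<Rightarrow> 'a) \<Rightarrow> 'i stream \<Rightarrow> 'a" where
  "canonical_projection f \<omega> = (THE x. \<forall>B\<in>nonempty_compacts.
     (\<lambda>n. hausdorff_pompeiu (word_map f (stake n \<omega>) ` B) {x}) \<longlonglongrightarrow> 0)"

lemma stream_neq_imp_snth_neq: "\<alpha> \<noteq> \<beta> \<Longrightarrow> \<exists>n. \<alpha> !! n \<noteq> \<beta> !! n"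
  by (metis smap_alt stream.map_id0 id_apply)

lemma word_dist_le:
  assumes "\<And>k. k < n \<Longrightarrow> \<alpha> !! k = \<beta> !! k"
  shows "word_dist \<alpha> \<beta> \<le> (1 / 2) ^ Suc n"
proof (cases "\<alpha> = \<beta>")
  case False
  then have "\<alpha> !! (LEAST n. \<alpha> !! n \<noteq> \<beta> !! n) \<noteq> \<beta> !! (LEAST n. \<alpha> !! n \<noteq> \<beta> !! n)"
    using LeastI_ex[OF stream_neq_imp_snth_neq] by blast
  then have "n \<le> (LEAST n. \<alpha> !! n \<noteq> \<beta> !! n)"
    using assms by (meson not_le)
  with False show ?thesis
    unfolding word_dist_def by (simp add: power_decreasing del: power_one_over)
qed (simp add: word_dist_def)

text \<open>Hence \<open>Metric_space.mtopology (streams I) word_dist\<close> is the metric topology of the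
  space of infinite words.\<close>

lemma Metric_space_word_dist: "Metric_space (streams I) word_dist"
proof
  fix \<alpha> \<beta> \<gamma> :: "'a stream"
  show "0 \<le> word_dist \<alpha> \<beta>" by (simp add: word_dist_def)
  show "word_dist \<alpha> \<beta> = word_dist \<beta> \<alpha>" by (simp add: word_dist_def eq_commute)
  show "(word_dist \<alpha> \<beta> = 0) = (\<alpha> = \<beta>)" by (simp add: word_dist_def)
  show "word_dist \<alpha> \<gamma> \<le> word_dist \<alpha> \<beta> + word_dist \<beta> \<gamma>"
  proof (cases "\<alpha> = \<beta> \<or> \<beta> = \<gamma>")
    case False
    let ?m = "LEAST n. \<alpha> !! n \<noteq> \<beta> !! n" and ?n = "LEAST n. \<beta> !! n \<noteq> \<gamma> !! n"
    have "word_dist \<alpha> \<gamma> \<le> (1 / 2) ^ Suc (min ?m ?n)"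
    proof (rule word_dist_le)
      fix k assume "k < min ?m ?n"
      then have "\<alpha> !! k = \<beta> !! k" "\<beta> !! k = \<gamma> !! k"
        using not_less_Least[of k "\<lambda>n. \<alpha> !! n \<noteq> \<beta> !! n"]
          not_less_Least[of k "\<lambda>n. \<beta> !! n \<noteq> \<gamma> !! n"] by auto
      then show "\<alpha> !! k = \<gamma> !! k" by simp
    qed
    also have "\<dots> \<le> (1 / 2) ^ Suc ?m + (1 / 2) ^ Suc ?n"
      by (simp add: min_def)
    finally show ?thesis using False by (simp add: word_dist_def)
  qed (auto simp: word_dist_def)
qed

end

theory Submission
  imports Defs
begin

text \<open>
  In a convex contraction condition the distance after two steps is bounded by a combination,
  with total weight \<open>< 1\<close>, of distances after zero and one steps. Unfolding a word two letters at
  a time, the distance between the images of two points under any word of length \<open>n\<close> therefore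
  decays like \<open>q ^ n\<close> for some \<open>q < 1\<close>, uniformly over all words, although no single \<open>f i\<close> has to
  be a contraction (\<open>word_map_contracting\<close>).

  Hence for a fixed point \<open>x\<close> the sequence \<open>word_map f (stake n \<omega>) x\<close> is Cauchy uniformly in \<open>\<omega>\<close>,
  and its limit does not depend on \<open>x\<close>; the convergence is even uniform in \<open>\<omega>\<close> and in \<open>x\<close> ranging
  over a compact set (\<open>uniform_limit_canonical_projection\<close>). The three properties follow from this.
  The approximants depend only on finitely many letters, so their uniform limit is continuous.
  Equivariance is the passage to the limit in \<open>word_map f (i # w) x = f i (word_map f w x)\<close>.
  For surjectivity, the space of words is compact by the theorem of Tychonoff, so the set
  of limits is compact; since \<open>n\<close> iterations of the operator apply exactly the words of length \<open>n\<close>,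
  uniform convergence makes that set the Hausdorff limit of all the iterates, that is, the
  attractor.\<close>

section \<open>The metric space of words\<close>

lemma word_dist_less_power_iff:
  "word_dist \<alpha> \<beta> < (1 / 2) ^ n \<longleftrightarrow> stake n \<alpha> = stake n \<beta>"
proof
  assume less: "word_dist \<alpha> \<beta> < (1 / 2) ^ n"
  show "stake n \<alpha> = stake n \<beta>"
  proof (rule nth_equalityI)
    fix k assume "k < length (stake n \<alpha>)"
    then have k: "k < n" by simp
    have "\<alpha> !! k = \<beta> !! k"
    proof (rule ccontr)
      assume neq: "\<alpha> !! k \<noteq> \<beta> !! k"
      have "(LEAST m. \<alpha> !! m \<noteq> \<beta> !! m) \<le> k"
        using neq by (rule Least_le)
      then have "Suc (LEAST m. \<alpha> !! m \<noteq> \<beta> !! m) \<le> n"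
        using k by simp
      then have "(1 / 2 :: real) ^ n \<le> (1 / 2) ^ Suc (LEAST m. \<alpha> !! m \<noteq> \<beta> !! m)"
        by (intro power_decreasing) auto
      moreover have "\<alpha> \<noteq> \<beta>" using neq by auto
      ultimately show False using less by (simp add: word_dist_def del: power_Suc)
    qed
    then show "stake n \<alpha> ! k = stake n \<beta> ! k" using k by simp
  qed simp
next
  assume eq: "stake n \<alpha> = stake n \<beta>"
  have "word_dist \<alpha> \<beta> \<le> (1 / 2) ^ Suc n"
    by (rule word_dist_le) (metis eq stake_nth)
  also have "\<dots> < (1 / 2) ^ n" by simp
  finally show "word_dist \<alpha> \<beta> < (1 / 2) ^ n" .
qed

lemma continuous_map_from_streams:
  fixes g :: "'i stream \<Rightarrow> 'a::metric_space"
  assumes "\<And>\<omega> e. \<omega> \<in> streams I \<Longrightarrow> 0 < e \<Longrightarrow>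
    \<exists>n. \<forall>\<eta>\<in>streams I. stake n \<eta> = stake n \<omega> \<longrightarrow> dist (g \<eta>) (g \<omega>) < e"
  shows "continuous_map (Metric_space.mtopology (streams I) word_dist) euclidean g"
proof -
  interpret W: Metric_space "streams I" word_dist
    by (rule Metric_space_word_dist)
  have "\<exists>r>0. W.mball \<omega> r \<subseteq> {x \<in> streams I. g x \<in> U}"
    if U: "open U" and \<omega>: "\<omega> \<in> streams I" "g \<omega> \<in> U" for U \<omega>
  proof -
    obtain e where e: "e > 0" "ball (g \<omega>) e \<subseteq> U"
      using U \<omega> by (auto simp: open_contains_ball)
    obtain n where n: "\<forall>\<eta>\<in>streams I. stake n \<eta> = stake n \<omega> \<longrightarrow> dist (g \<eta>) (g \<omega>) < e"
      using assms[OF \<omega>(1) e(1)] by blast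
    have "W.mball \<omega> ((1 / 2) ^ n) \<subseteq> {x \<in> streams I. g x \<in> U}"
    proof
      fix \<eta> assume "\<eta> \<in> W.mball \<omega> ((1 / 2) ^ n)"
      then have \<eta>: "\<eta> \<in> streams I" "word_dist \<omega> \<eta> < (1 / 2) ^ n"
        by (simp_all add: W.in_mball)
      then have "stake n \<eta> = stake n \<omega>"
        using word_dist_less_power_iff by metis
      then have "g \<eta> \<in> ball (g \<omega>) e"
        using n \<eta>(1) by (simp add: dist_commute)
      then show "\<eta> \<in> {x \<in> streams I. g x \<in> U}"
        using e(2) \<eta>(1) by blast
    qed
    then show ?thesis
      by (intro exI[of _ "(1 / 2) ^ n"]) simp
  qed
  then show ?thesis
    by (auto simp: continuous_map_def W.openin_mtopology)
qed

text \<open>The topology of the word metric is the product topology: a word metric ball only restricts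
  finitely many letters. So this is an instance of the theorem of Tychonoff.\<close>

lemma compact_space_streams:
  assumes "finite I"
  shows "compact_space (Metric_space.mtopology (streams I) word_dist)"
proof -
  interpret W: Metric_space "streams I" word_dist
    by (rule Metric_space_word_dist)
  let ?X = "product_topology (\<lambda>_::nat. discrete_topology I) UNIV"
  let ?s = "\<lambda>h. smap h nats"
  have topX: "topspace ?X = (\<Pi>\<^sub>E k\<in>UNIV. I)"
    by simp
  have "continuous_map ?X W.mtopology ?s"
    unfolding W.continuous_map_to_metric
  proof (intro ballI allI impI)
    fix h and e :: real
    assume h: "h \<in> topspace ?X" and "0 < e"
    then obtain n where n: "(1 / 2) ^ n < e"
      using real_arch_pow_inv[of e "1 / 2"] by auto
    let ?U = "\<Pi>\<^sub>E k\<in>UNIV. if k < n then {h k} else I"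
    have hI: "h k \<in> I" for k
      using h by auto
    have "finite {k. (if k < n then {h k} else I) \<noteq> topspace (discrete_topology I)}"
      by (rule finite_subset[of _ "{..<n}"]) auto
    then have "openin ?X ?U"
      using hI by (intro product_topology_basis) auto
    moreover have "h \<in> ?U" using hI by auto
    moreover have "?s g \<in> W.mball (?s h) e" if "g \<in> ?U" for g
    proof -
      have g: "g k \<in> (if k < n then {h k} else I)" for k
        using that by (rule PiE_mem) simp
      have "g k = h k" if "k < n" for k
        using g[of k] that by simp
      then have "stake n (?s h) = stake n (?s g)"
        by (intro nth_equalityI) simp_all
      then have "word_dist (?s h) (?s g) < (1 / 2) ^ n"
        by (simp only: word_dist_less_power_iff)
      moreover have "g k \<in> I" for k
        using g[of k] hI[of k] by (auto split: if_splits)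
      ultimately show ?thesis
        using n hI by (simp add: W.in_mball streams_iff_snth)
    qed
    ultimately show "\<exists>U. openin ?X U \<and> h \<in> U \<and> (\<forall>g\<in>U. ?s g \<in> W.mball (?s h) e)"
      by blast
  qed
  moreover have "compactin ?X (topspace ?X)"
    using assms
    by (simp add: compact_space_def[symmetric] compact_space_product_topology
        compact_space_discrete_topology del: topspace_product_topology)
  ultimately have "compactin W.mtopology (?s ` topspace ?X)"
    by (metis image_compactin)
  moreover have "?s ` topspace ?X = streams I"
  proof (intro equalityI subsetI)
    fix \<omega> assume "\<omega> \<in> streams I"
    then have "snth \<omega> \<in> topspace ?X"
      by (simp add: streams_iff_snth PiE_iff)
    then show "\<omega> \<in> ?s ` topspace ?X"
      using stream_smap_nats[of \<omega>] by blast
  qed (auto simp: streams_iff_snth)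
  ultimately show ?thesis
    by (simp add: compact_space_def)
qed

section \<open>Limits in the Hausdorff-Pompeiu distance\<close>

lemma hausdorff_pompeiu_nonneg:
  assumes "A \<noteq> {}"
  shows "0 \<le> hausdorff_pompeiu S A"
proof -
  obtain a where "a \<in> A" using assms by blast
  have "0 \<le> (INF y\<in>S. ereal (dist a y))"
    by (intro INF_greatest) simp
  also have "\<dots> \<le> set_excess A S"
    unfolding set_excess_def by (rule SUP_upper) fact
  finally show ?thesis
    by (simp add: hausdorff_pompeiu_def le_max_iff_disj)
qed

lemma set_excess_less_imp:
  assumes "set_excess A B < ereal e" "x \<in> A"
  shows "\<exists>y\<in>B. dist x y < e"
proof -
  have "(INF y\<in>B. ereal (dist x y)) \<le> set_excess A B"
    unfolding set_excess_def by (rule SUP_upper) fact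
  then have "(INF y\<in>B. ereal (dist x y)) < ereal e"
    using assms(1) by simp
  then show ?thesis by (simp add: INF_less_iff)
qed

lemma set_excess_le:
  assumes "\<And>x. x \<in> A \<Longrightarrow> \<exists>y\<in>B. dist x y \<le> e"
  shows "set_excess A B \<le> ereal e"
  unfolding set_excess_def
proof (rule SUP_least)
  fix x assume "x \<in> A"
  then obtain y where y: "y \<in> B" "dist x y \<le> e" using assms by blast
  then show "(INF y\<in>B. ereal (dist x y)) \<le> ereal e"
    by (intro INF_lower2[of y]) auto
qed

lemma hausdorff_tendsto_zero_iff:
  assumes "A \<noteq> {}"
  shows "(\<lambda>n. hausdorff_pompeiu (S n) A) \<longlonglongrightarrow> 0 \<longleftrightarrow>
    (\<forall>e>0. \<forall>\<^sub>F n in sequentially.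
       (\<forall>x\<in>S n. \<exists>y\<in>A. dist x y < e) \<and> (\<forall>y\<in>A. \<exists>x\<in>S n. dist y x < e))"
    (is "?L \<longleftrightarrow> ?R")
proof
  assume L: ?L
  show ?R
  proof (intro allI impI)
    fix e :: real assume "e > 0"
    then have "\<forall>\<^sub>F n in sequentially. hausdorff_pompeiu (S n) A < ereal e"
      by (intro order_tendstoD(2)[OF L]) simp
    then show "\<forall>\<^sub>F n in sequentially.
       (\<forall>x\<in>S n. \<exists>y\<in>A. dist x y < e) \<and> (\<forall>y\<in>A. \<exists>x\<in>S n. dist y x < e)"
      by eventually_elim (auto simp: hausdorff_pompeiu_def intro: set_excess_less_imp)
  qed
next
  assume R: ?R
  show ?L
  proof (rule order_tendstoI)
    fix u :: ereal assume "0 < u"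
    then obtain e where e: "0 < ereal e" "ereal e < u"
      using ereal_dense2 by blast
    then have "\<forall>\<^sub>F n in sequentially.
       (\<forall>x\<in>S n. \<exists>y\<in>A. dist x y < e) \<and> (\<forall>y\<in>A. \<exists>x\<in>S n. dist y x < e)"
      using R by simp
    then show "\<forall>\<^sub>F n in sequentially. hausdorff_pompeiu (S n) A < u"
    proof eventually_elim
      case (elim n)
      then have "hausdorff_pompeiu (S n) A \<le> ereal e"
        unfolding hausdorff_pompeiu_def
        by (intro max.boundedI set_excess_le) (meson less_imp_le)+
      then show ?case using e(2) by simp
    qed
  next
    fix l :: ereal assume "l < 0"
    then have "l < hausdorff_pompeiu (S n) A" for n
      using hausdorff_pompeiu_nonneg[OF assms, of "S n"] by simp
    then show "\<forall>\<^sub>F n in sequentially. l < hausdorff_pompeiu (S n) A"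
      by simp
  qed
qed

text \<open>Applied in both directions this is uniqueness of Hausdorff limits among nonempty closed sets,
  which turns a limit that has been found into the value of a definite description.\<close>

lemma hausdorff_limit_subset:
  assumes "A \<noteq> {}" "(\<lambda>n. hausdorff_pompeiu (S n) A) \<longlonglongrightarrow> 0"
    and "B \<noteq> {}" "closed B" "(\<lambda>n. hausdorff_pompeiu (S n) B) \<longlonglongrightarrow> 0"
  shows "A \<subseteq> B"
proof
  fix x assume x: "x \<in> A"
  have "\<exists>z\<in>B. dist z x < e" if "e > 0" for e
  proof -
    have "\<forall>\<^sub>F n in sequentially. \<forall>x\<in>A. \<exists>y\<in>S n. dist x y < e / 2"
      using assms(2) \<open>e > 0\<close> unfolding hausdorff_tendsto_zero_iff[OF assms(1)]
      by (auto elim!: allE[of _ "e / 2"] elim: eventually_mono)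
    moreover have "\<forall>\<^sub>F n in sequentially. \<forall>y\<in>S n. \<exists>z\<in>B. dist y z < e / 2"
      using assms(5) \<open>e > 0\<close> unfolding hausdorff_tendsto_zero_iff[OF assms(3)]
      by (auto elim!: allE[of _ "e / 2"] elim: eventually_mono)
    ultimately have "\<forall>\<^sub>F n in sequentially. \<exists>z\<in>B. dist z x < e"
    proof eventually_elim
      case (elim n)
      then obtain y z where "z \<in> B" "dist x y < e / 2" "dist y z < e / 2"
        using x by blast
      then show ?case
        by (metis dist_commute dist_triangle_half_r)
    qed
    then show ?thesis
      by (simp add: eventually_sequentially) blast
  qed
  then show "x \<in> B"
    using \<open>closed B\<close> closed_approachable by blast
qed

section \<open>Exponential contraction along words\<close>

lemma word_map_Nil [simp]: "word_map f [] = id"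
  by (simp add: word_map_def)

lemma word_map_Cons [simp]: "word_map f (i # w) = f i \<circ> word_map f w"
  by (simp add: word_map_def)

lemma word_map_append: "word_map f (v @ w) = word_map f v \<circ> word_map f w"
  by (induction v) (simp_all add: comp_assoc)

lemma set_stake_subset: "\<omega> \<in> streams I \<Longrightarrow> set (stake n \<omega>) \<subseteq> I"
  by (auto simp: set_conv_nth streams_iff_snth)

text \<open>Two steps gain a factor \<open>q\<^sup>2\<close> on the worse of the two preceding distances, so the estimate
  needs as input both the initial distance and the distances after one step.\<close>

definition one_step_gap :: "'i set \<Rightarrow> ('i \<Rightarrow> 'a::metric_space \<Rightarrow> 'a) \<Rightarrow> 'a \<Rightarrow> 'a \<Rightarrow> real" where
  "one_step_gap I f x y = dist x y + (\<Sum>i\<in>I. dist (f i x) (f i y))"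

lemma one_step_gap_nonneg: "0 \<le> one_step_gap I f x y"
  by (simp add: one_step_gap_def sum_nonneg)

lemma one_step_gap_bounded:
  assumes "convex_contraction_IFS I f" "compact B"
  shows "\<exists>G. \<forall>b\<in>B. one_step_gap I f b x \<le> G"
proof -
  have "continuous_on B (\<lambda>b. one_step_gap I f b x)"
    using assms(1) unfolding convex_contraction_IFS_def one_step_gap_def
    by (intro continuous_intros) (auto intro: continuous_on_subset)
  then have "compact ((\<lambda>b. one_step_gap I f b x) ` B)"
    using assms(2) by (rule compact_continuous_image)
  then have "bdd_above ((\<lambda>b. one_step_gap I f b x) ` B)"
    by (intro bounded_imp_bdd_above compact_imp_bounded)
  then show ?thesis
    by (auto simp: bdd_above_def)
qed

text \<open>Splitting off the first two letters of \<open>i # j # v\<close> bounds the distance by the distances for \<open>v\<close>,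
  \<open>i # v\<close> and \<open>j # v\<close>. As \<open>i # v\<close> is not a suffix of the word, the induction has to run over the
  length and treat all words simultaneously.\<close>

lemma word_map_contracting:
  fixes f :: "'i \<Rightarrow> 'a::metric_space \<Rightarrow> 'a"
  assumes "convex_contraction_IFS I f"
  obtains q K where "0 < q" "q < 1" "0 < K"
    "\<And>w x y. set w \<subseteq> I \<Longrightarrow>
       dist (word_map f w x) (word_map f w y) \<le> K * q ^ length w * one_step_gap I f x y"
proof -
  obtain a b c :: "'i \<Rightarrow> 'i \<Rightarrow> real" where fin: "finite I" "I \<noteq> {}"
    and nonneg: "\<forall>i\<in>I. \<forall>j\<in>I. 0 \<le> a i j \<and> 0 \<le> b i j \<and> 0 \<le> c i j"
    and Max: "Max ((\<lambda>(i, j). a i j + b i j + c i j) ` (I \<times> I)) < 1" (is "?D < 1")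
    and step: "\<forall>i\<in>I. \<forall>j\<in>I. \<forall>x y. dist ((f i \<circ> f j) x) ((f i \<circ> f j) y)
             \<le> a i j * dist x y + b i j * dist (f i x) (f i y) + c i j * dist (f j x) (f j y)"
    using assms unfolding convex_contraction_IFS_def by blast
  \<comment> \<open>The bound \<open>1 / 4\<close> only keeps \<open>q\<close> away from \<open>0\<close>, so that \<open>1 / q\<close> can absorb the loss in words of
     length one, which are not contracted.\<close>
  define q where "q = sqrt (max ?D (1 / 4))"
  have q: "0 < q" "q < 1" and q2: "?D \<le> q\<^sup>2"
    using Max by (auto simp: q_def)
  have abc: "a i j + b i j + c i j \<le> q\<^sup>2" if "i \<in> I" "j \<in> I" for i j
  proof -
    have "a i j + b i j + c i j \<le> ?D"
      using that fin by (intro Max_ge) (auto intro!: image_eqI[of _ _ "(i, j)"])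
    then show ?thesis using q2 by simp
  qed
  have "dist (word_map f w x) (word_map f w y) \<le> 1 / q * q ^ length w * one_step_gap I f x y"
    if "set w \<subseteq> I" for w x y
    using that
  proof (induction w rule: length_induct)
    case (1 w)
    let ?g = "one_step_gap I f x y"
    have g0: "0 \<le> ?g" by (rule one_step_gap_nonneg)
    consider "w = []" | i where "w = [i]" | i j v where "w = i # j # v"
      by (metis list.exhaust)
    then show ?case
    proof cases
      case 1
      have "dist x y \<le> ?g"
        by (simp add: one_step_gap_def sum_nonneg)
      also have "\<dots> \<le> 1 / q * ?g"
        using q g0 mult_right_mono[of 1 "1 / q" ?g] by simp
      finally show ?thesis using 1 by simp
    next
      case 2
      have "dist (f i x) (f i y) \<le> (\<Sum>i\<in>I. dist (f i x) (f i y))"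
        using 2 "1.prems" fin by (intro member_le_sum) auto
      then show ?thesis using 2 q by (simp add: one_step_gap_def add_increasing)
    next
      case 3
      define M where "M = 1 / q * q ^ length v * ?g"
      have M0: "0 \<le> M" using q g0 by (simp add: M_def)
      have ij: "i \<in> I" "j \<in> I" and v: "set v \<subseteq> I"
        using "1.prems" 3 by auto
      have IH0: "dist (word_map f v x) (word_map f v y) \<le> M"
        using "1.IH" 3 v by (simp add: M_def)
      have IH1: "dist (f k (word_map f v x)) (f k (word_map f v y)) \<le> M" if k: "k \<in> I" for k
      proof -
        have "length (k # v) < length w" "set (k # v) \<subseteq> I"
          using 3 v k by auto
        then have "dist (word_map f (k # v) x) (word_map f (k # v) y)
            \<le> 1 / q * q ^ length (k # v) * ?g"
          using "1.IH" by blast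
        then have "dist (f k (word_map f v x)) (f k (word_map f v y)) \<le> q * M"
          using q(1) by (simp add: M_def mult_ac)
        also have "\<dots> \<le> M" using q M0 by (simp add: mult_left_le_one_le)
        finally show ?thesis .
      qed
      have "dist (word_map f w x) (word_map f w y) \<le> a i j * M + b i j * M + c i j * M"
      proof -
        let ?x = "word_map f v x" and ?y = "word_map f v y"
        have "dist (word_map f w x) (word_map f w y)
            \<le> a i j * dist ?x ?y + b i j * dist (f i ?x) (f i ?y) + c i j * dist (f j ?x) (f j ?y)"
          using step ij by (simp add: 3)
        also have "\<dots> \<le> a i j * M + b i j * M + c i j * M"
          using nonneg ij by (intro add_mono mult_left_mono IH0 IH1) auto
        finally show ?thesis .
      qed
      also have "\<dots> = (a i j + b i j + c i j) * M" by (simp add: algebra_simps)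
      also have "\<dots> \<le> q\<^sup>2 * M"
        using abc[OF ij] M0 by (rule mult_right_mono)
      also have "\<dots> = 1 / q * q ^ length w * ?g"
        by (simp add: 3 M_def power2_eq_square)
      finally show ?thesis .
    qed
  qed
  then show thesis using q that[of q "1 / q"] by simp
qed

section \<open>The canonical projection as a uniform limit\<close>

text \<open>Lengthening the prefix by one letter \<open>i\<close> replaces \<open>x\<close> by \<open>f i x\<close> inside a word of length
  \<open>n\<close>; as there are finitely many letters, consecutive approximants are \<open>O(q ^ n)\<close> apart,
  uniformly over all words.\<close>

lemma uniformly_Cauchy_word_map:
  assumes "convex_contraction_IFS I f"
  shows "uniformly_Cauchy_on (streams I) (\<lambda>n \<omega>. word_map f (stake n \<omega>) x)"
proof -
  obtain q K where q: "0 < q" "q < 1" "0 < K"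
    and contr: "\<And>w x y. set w \<subseteq> I \<Longrightarrow>
       dist (word_map f w x) (word_map f w y) \<le> K * q ^ length w * one_step_gap I f x y"
    using word_map_contracting[OF assms] by blast
  have fin: "finite I" using assms by (simp add: convex_contraction_IFS_def)
  define C where "C = K * (\<Sum>i\<in>I. one_step_gap I f x (f i x))"
  have C0: "0 \<le> C" using q by (simp add: C_def sum_nonneg one_step_gap_nonneg)
  have consecutive: "dist (word_map f (stake n \<omega>) x) (word_map f (stake (Suc n) \<omega>) x) \<le> C * q ^ n"
    if \<omega>: "\<omega> \<in> streams I" for n \<omega>
  proof -
    have "word_map f (stake (Suc n) \<omega>) x = word_map f (stake n \<omega>) (f (\<omega> !! n) x)"
      by (simp add: stake_Suc word_map_append del: stake.simps)
    then have "dist (word_map f (stake n \<omega>) x) (word_map f (stake (Suc n) \<omega>) x)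
        \<le> K * q ^ n * one_step_gap I f x (f (\<omega> !! n) x)"
      using contr[OF set_stake_subset[OF \<omega>, of n], of x "f (\<omega> !! n) x"] by simp
    also have "\<dots> \<le> K * q ^ n * (\<Sum>i\<in>I. one_step_gap I f x (f i x))"
      using \<omega> fin q
      by (intro mult_left_mono member_le_sum) (auto simp: one_step_gap_nonneg snth_in)
    finally show ?thesis by (simp add: C_def mult_ac)
  qed
  \<comment> \<open>The partial geometric sum from \<open>m\<close> to \<open>m + k\<close>, in closed form.\<close>
  have geometric: "dist (word_map f (stake m \<omega>) x) (word_map f (stake (m + k) \<omega>) x)
      \<le> C / (1 - q) * (q ^ m - q ^ (m + k))" if \<omega>: "\<omega> \<in> streams I" for m k \<omega>
  proof (induction k)
    case (Suc k)
    have "dist (word_map f (stake m \<omega>) x) (word_map f (stake (m + Suc k) \<omega>) x)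
        \<le> C / (1 - q) * (q ^ m - q ^ (m + k)) + C * q ^ (m + k)"
      using Suc consecutive[OF \<omega>, of "m + k"] dist_triangle
      by (smt (verit) add_Suc_right)
    also have "C * q ^ (m + k) = C / (1 - q) * (q ^ (m + k) - q ^ (m + Suc k))"
    proof -
      have "q ^ (m + k) - q ^ (m + Suc k) = q ^ (m + k) * (1 - q)"
        by (simp add: algebra_simps)
      then show ?thesis using q by simp
    qed
    finally show ?case by (simp add: algebra_simps)
  qed simp
  show ?thesis
  proof (rule uniformly_Cauchy_onI')
    fix e :: real assume e: "e > 0"
    have "(\<lambda>m. C / (1 - q) * q ^ m) \<longlonglongrightarrow> C / (1 - q) * 0"
      using q by (intro tendsto_intros LIMSEQ_power_zero) simp
    then have "\<forall>\<^sub>F m in sequentially. C / (1 - q) * q ^ m < e"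
      using e by (intro order_tendstoD(2)) simp_all
    then obtain N where N: "\<And>m. m \<ge> N \<Longrightarrow> C / (1 - q) * q ^ m < e"
      by (auto simp: eventually_sequentially)
    have "dist (word_map f (stake m \<omega>) x) (word_map f (stake n \<omega>) x) < e"
      if \<omega>: "\<omega> \<in> streams I" and mn: "m \<ge> N" "n > m" for \<omega> m n
    proof -
      have "dist (word_map f (stake m \<omega>) x) (word_map f (stake n \<omega>) x)
          \<le> C / (1 - q) * (q ^ m - q ^ n)"
        using geometric[OF \<omega>, of m "n - m"] mn(2) by simp
      also have "\<dots> \<le> C / (1 - q) * q ^ m"
        using q C0 by (intro mult_left_mono) auto
      also have "\<dots> < e" using N mn(1) by simp
      finally show ?thesis .
    qed
    then show "\<exists>M. \<forall>\<omega>\<in>streams I. \<forall>m\<ge>M. \<forall>n>m.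
        dist (word_map f (stake m \<omega>) x) (word_map f (stake n \<omega>) x) < e"
      by blast
  qed
qed

text \<open>Exponential contraction makes the limit independent of the starting point, uniformly as long
  as the gap to a reference point \<open>x\<close> stays bounded; on a compact set it does.\<close>

lemma uniform_limit_word_map_exists:
  fixes f :: "'i \<Rightarrow> 'a::complete_space \<Rightarrow> 'a"
  assumes ifs: "convex_contraction_IFS I f"
  shows "\<exists>p. \<forall>B. compact B \<longrightarrow>
    uniform_limit (streams I \<times> B) (\<lambda>n (\<omega>, b). word_map f (stake n \<omega>) b) (\<lambda>(\<omega>, b). p \<omega>) sequentially"
proof -
  obtain q K where q: "0 < q" "q < 1" "0 < K"
    and contr: "\<And>w x y. set w \<subseteq> I \<Longrightarrow>
       dist (word_map f w x) (word_map f w y) \<le> K * q ^ length w * one_step_gap I f x y"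
    using word_map_contracting[OF ifs] by blast
  obtain x :: 'a where True by simp
  obtain p where p: "uniform_limit (streams I) (\<lambda>n \<omega>. word_map f (stake n \<omega>) x) p sequentially"
    using Cauchy_uniformly_convergent[OF uniformly_Cauchy_word_map[OF ifs]]
    unfolding uniformly_convergent_on_def by blast
  have "uniform_limit (streams I \<times> B) (\<lambda>n (\<omega>, b). word_map f (stake n \<omega>) b) (\<lambda>(\<omega>, b). p \<omega>)
      sequentially" if B: "compact B" for B
    unfolding uniform_limit_iff
  proof (intro allI impI)
    fix e :: real assume e: "e > 0"
    obtain G where G: "\<And>b. b \<in> B \<Longrightarrow> one_step_gap I f b x \<le> G"
      using one_step_gap_bounded[OF ifs B] by blast
    have "\<forall>\<^sub>F n in sequentially. \<forall>\<omega>\<in>streams I. dist (word_map f (stake n \<omega>) x) (p \<omega>) < e / 2"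
      using p half_gt_zero[OF e] unfolding uniform_limit_iff by blast
    moreover have "\<forall>\<^sub>F n in sequentially. K * q ^ n * G < e / 2"
    proof -
      have "(\<lambda>n. K * q ^ n * G) \<longlonglongrightarrow> K * 0 * G"
        using q by (intro tendsto_intros LIMSEQ_power_zero) simp
      then have "(\<lambda>n. K * q ^ n * G) \<longlonglongrightarrow> 0" by simp
      then show ?thesis using half_gt_zero[OF e] by (rule order_tendstoD(2))
    qed
    ultimately show "\<forall>\<^sub>F n in sequentially. \<forall>z\<in>streams I \<times> B.
        dist (case z of (\<omega>, b) \<Rightarrow> word_map f (stake n \<omega>) b) (case z of (\<omega>, b) \<Rightarrow> p \<omega>) < e"
    proof eventually_elim
      case (elim n)
      have "dist (word_map f (stake n \<omega>) b) (p \<omega>) < e" if "\<omega> \<in> streams I" "b \<in> B" for \<omega> b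
      proof -
        have "dist (word_map f (stake n \<omega>) b) (word_map f (stake n \<omega>) x)
            \<le> K * q ^ n * one_step_gap I f b x"
          using contr[OF set_stake_subset[OF that(1), of n], of b x] by simp
        also have "\<dots> \<le> K * q ^ n * G"
          using q G[OF that(2)] by (intro mult_left_mono) auto
        also have "\<dots> < e / 2" using elim(2) .
        finally show ?thesis
          using elim(1) that(1) by (metis dist_commute dist_triangle_half_r)
      qed
      then show ?case by auto
    qed
  qed
  then show ?thesis by blast
qed

lemma uniform_limit_canonical_projection:
  fixes f :: "'i \<Rightarrow> 'a::complete_space \<Rightarrow> 'a"
  assumes ifs: "convex_contraction_IFS I f" and "compact B"
  shows "uniform_limit (streams I \<times> B) (\<lambda>n (\<omega>, b). word_map f (stake n \<omega>) b)
    (\<lambda>(\<omega>, b). canonical_projection f \<omega>) sequentially"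
proof -
  obtain p where p: "\<And>B. compact B \<Longrightarrow>
      uniform_limit (streams I \<times> B) (\<lambda>n (\<omega>, b). word_map f (stake n \<omega>) b) (\<lambda>(\<omega>, b). p \<omega>) sequentially"
    using uniform_limit_word_map_exists[OF ifs] by blast
  have "canonical_projection f \<omega> = p \<omega>" if \<omega>: "\<omega> \<in> streams I" for \<omega>
    unfolding canonical_projection_def
  proof (rule the_equality)
    show lim: "\<forall>B\<in>nonempty_compacts.
        (\<lambda>n. hausdorff_pompeiu (word_map f (stake n \<omega>) ` B) {p \<omega>}) \<longlonglongrightarrow> 0"
    proof
      fix B :: "'a set" assume B: "B \<in> nonempty_compacts"
      then obtain b where b: "b \<in> B" and "compact B"
        by (auto simp: nonempty_compacts_def)
      have "\<forall>\<^sub>F n in sequentially. (\<forall>x\<in>word_map f (stake n \<omega>) ` B. \<exists>y\<in>{p \<omega>}. dist x y < e) \<and>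
          (\<forall>y\<in>{p \<omega>}. \<exists>x\<in>word_map f (stake n \<omega>) ` B. dist y x < e)" if "e > 0" for e
      proof -
        have "\<forall>\<^sub>F n in sequentially. \<forall>z\<in>streams I \<times> B.
          dist (case z of (\<omega>, b) \<Rightarrow> word_map f (stake n \<omega>) b) (case z of (\<omega>, b) \<Rightarrow> p \<omega>) < e"
          using p[OF \<open>compact B\<close>] that unfolding uniform_limit_iff by blast
        then show ?thesis
          by eventually_elim (use \<omega> b in \<open>auto simp: dist_commute\<close>)
      qed
      then show "(\<lambda>n. hausdorff_pompeiu (word_map f (stake n \<omega>) ` B) {p \<omega>}) \<longlonglongrightarrow> 0"
        by (subst hausdorff_tendsto_zero_iff) auto
    qed
    fix y assume y: "\<forall>B\<in>nonempty_compacts.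
        (\<lambda>n. hausdorff_pompeiu (word_map f (stake n \<omega>) ` B) {y}) \<longlonglongrightarrow> 0"
    have "{undefined} \<in> (nonempty_compacts :: 'a set set)"
      by (simp add: nonempty_compacts_def)
    then have "{y} \<subseteq> {p \<omega>}"
      using lim y by (intro hausdorff_limit_subset) auto
    then show "y = p \<omega>" by simp
  qed
  then show ?thesis
    using p[OF \<open>compact B\<close>] by (subst uniform_limit_cong') auto
qed

lemma canonical_projection_tendsto:
  fixes f :: "'i \<Rightarrow> 'a::complete_space \<Rightarrow> 'a"
  assumes "convex_contraction_IFS I f" "\<omega> \<in> streams I"
  shows "(\<lambda>n. word_map f (stake n \<omega>) x) \<longlonglongrightarrow> canonical_projection f \<omega>"
  using tendsto_uniform_limitI[OF uniform_limit_canonical_projection[OF assms(1), of "{x}"],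
      of "(\<omega>, x)"] assms(2) by simp

section \<open>Continuity and equivariance\<close>

lemma continuous_map_canonical_projection:
  fixes f :: "'i \<Rightarrow> 'a::complete_space \<Rightarrow> 'a"
  assumes ifs: "convex_contraction_IFS I f"
  shows "continuous_map (Metric_space.mtopology (streams I) word_dist) euclidean
    (canonical_projection f)"
proof (rule continuous_map_from_streams)
  fix \<omega> and e :: real assume \<omega>: "\<omega> \<in> streams I" and e: "e > 0"
  obtain x :: 'a where True by simp
  have "\<forall>\<^sub>F n in sequentially. \<forall>z\<in>streams I \<times> {x}.
      dist (case z of (\<omega>, b) \<Rightarrow> word_map f (stake n \<omega>) b)
        (case z of (\<omega>, b) \<Rightarrow> canonical_projection f \<omega>) < e / 2"
    using uniform_limit_canonical_projection[OF ifs compact_sing] half_gt_zero[OF e]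
    unfolding uniform_limit_iff by blast
  then obtain n where n: "\<And>\<eta>. \<eta> \<in> streams I \<Longrightarrow>
      dist (word_map f (stake n \<eta>) x) (canonical_projection f \<eta>) < e / 2"
    by (auto simp: eventually_sequentially)
  have "dist (canonical_projection f \<eta>) (canonical_projection f \<omega>) < e"
    if "\<eta> \<in> streams I" "stake n \<eta> = stake n \<omega>" for \<eta>
    using n[OF that(1)] n[OF \<omega>] that(2) by (metis dist_triangle_half_r)
  then show "\<exists>n. \<forall>\<eta>\<in>streams I. stake n \<eta> = stake n \<omega> \<longrightarrow>
      dist (canonical_projection f \<eta>) (canonical_projection f \<omega>) < e"
    by blast
qed

lemma canonical_projection_Stream:
  fixes f :: "'i \<Rightarrow> 'a::complete_space \<Rightarrow> 'a"
  assumes ifs: "convex_contraction_IFS I f" and i: "i \<in> I" and \<omega>: "\<omega> \<in> streams I"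
  shows "canonical_projection f (i ## \<omega>) = f i (canonical_projection f \<omega>)"
proof -
  obtain x :: 'a where True by simp
  have "isCont (f i) (canonical_projection f \<omega>)"
    using ifs i by (simp add: convex_contraction_IFS_def continuous_on_eq_continuous_at)
  then have equivariant: "(\<lambda>n. f i (word_map f (stake n \<omega>) x)) \<longlonglongrightarrow> f i (canonical_projection f \<omega>)"
    by (rule isCont_tendsto_compose[OF _ canonical_projection_tendsto[OF ifs \<omega>]])
  have "(\<lambda>n. word_map f (stake n (i ## \<omega>)) x) \<longlonglongrightarrow> canonical_projection f (i ## \<omega>)"
    using i \<omega> by (intro canonical_projection_tendsto[OF ifs]) (simp add: streams_Stream)
  then have "(\<lambda>n. f i (word_map f (stake n \<omega>) x)) \<longlonglongrightarrow> canonical_projection f (i ## \<omega>)"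
    by (subst (asm) filterlim_sequentially_Suc[symmetric]) simp
  then show ?thesis
    using equivariant by (rule LIMSEQ_unique)
qed

section \<open>The image of the projection is the attractor\<close>

lemma IFS_operator_funpow:
  "(IFS_operator I f ^^ n) B = (\<Union>w\<in>{w. set w \<subseteq> I \<and> length w = n}. word_map f w ` B)"
proof (induction n)
  case (Suc n)
  let ?W = "\<lambda>n. {w. set w \<subseteq> I \<and> length w = n}"
  have "(IFS_operator I f ^^ Suc n) B = (\<Union>i\<in>I. f i ` (\<Union>w\<in>?W n. word_map f w ` B))"
    unfolding funpow.simps comp_apply Suc by (simp only: IFS_operator_def)
  also have "\<dots> = (\<Union>i\<in>I. \<Union>w\<in>?W n. word_map f (i # w) ` B)"
    by (simp add: image_UN image_image)
  also have "\<dots> = (\<Union>w\<in>(\<Union>i\<in>I. (#) i ` ?W n). word_map f w ` B)"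
    by blast
  also have "(\<Union>i\<in>I. (#) i ` ?W n) = ?W (Suc n)"
    by (auto simp: length_Suc_conv)
  finally show ?case .
qed auto

lemma canonical_projection_image_nonempty_compact:
  fixes f :: "'i \<Rightarrow> 'a::complete_space \<Rightarrow> 'a"
  assumes ifs: "convex_contraction_IFS I f"
  shows "canonical_projection f ` streams I \<in> nonempty_compacts"
proof -
  interpret W: Metric_space "streams I" word_dist
    by (rule Metric_space_word_dist)
  have I: "finite I" "I \<noteq> {}"
    using ifs by (auto simp: convex_contraction_IFS_def)
  have "compactin W.mtopology (streams I)"
    using compact_space_streams[OF I(1)] by (simp add: compact_space_def)
  then have "compact (canonical_projection f ` streams I)"
    using image_compactin[OF _ continuous_map_canonical_projection[OF ifs]] by force
  then show ?thesis
    using I(2) by (simp add: nonempty_compacts_def streams_empty_iff)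
qed

text \<open>Both halves of the Hausdorff distance come from uniform convergence: a point of the \<open>n\<close>-th
  iterate is \<open>word_map f w b\<close> with \<open>w\<close> of length \<open>n\<close>, hence close to the projection of any infinite
  word with prefix \<open>w\<close>; conversely the projection of \<open>\<omega>\<close> is close to \<open>word_map f (stake n \<omega>) b\<close>.\<close>

lemma IFS_operator_iterates_tendsto:
  fixes f :: "'i \<Rightarrow> 'a::complete_space \<Rightarrow> 'a"
  assumes ifs: "convex_contraction_IFS I f" and B: "B \<in> nonempty_compacts"
  shows "(\<lambda>n. hausdorff_pompeiu ((IFS_operator I f ^^ n) B)
           (canonical_projection f ` streams I)) \<longlonglongrightarrow> 0"
proof -
  let ?A = "canonical_projection f ` streams I"
  have A: "?A \<noteq> {}"
    using canonical_projection_image_nonempty_compact[OF ifs] by (simp add: nonempty_compacts_def)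
  then obtain \<theta> where \<theta>: "\<theta> \<in> streams I" by blast
  obtain b where b: "b \<in> B" and "compact B"
    using B by (auto simp: nonempty_compacts_def)
  have "\<forall>\<^sub>F n in sequentially. (\<forall>x\<in>(IFS_operator I f ^^ n) B. \<exists>y\<in>?A. dist x y < e) \<and>
      (\<forall>y\<in>?A. \<exists>x\<in>(IFS_operator I f ^^ n) B. dist y x < e)" if "e > 0" for e
  proof -
    have "\<forall>\<^sub>F n in sequentially. \<forall>z\<in>streams I \<times> B.
      dist (case z of (\<omega>, b) \<Rightarrow> word_map f (stake n \<omega>) b)
        (case z of (\<omega>, b) \<Rightarrow> canonical_projection f \<omega>) < e"
      using uniform_limit_canonical_projection[OF ifs \<open>compact B\<close>] that
      unfolding uniform_limit_iff by blast
    then show ?thesis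
    proof eventually_elim
      case (elim n)
      then have close: "dist (word_map f (stake n \<omega>) b) (canonical_projection f \<omega>) < e"
        if "\<omega> \<in> streams I" "b \<in> B" for \<omega> b
        using that by auto
      have "\<exists>y\<in>?A. dist x y < e" if x: "x \<in> (IFS_operator I f ^^ n) B" for x
      proof -
        obtain w b' where w: "set w \<subseteq> I" "length w = n" and b': "b' \<in> B" "x = word_map f w b'"
          using x unfolding IFS_operator_funpow by blast
        have "w @- \<theta> \<in> streams I"
          using w(1) \<theta> by (simp add: streams_iff_sset)
        moreover have "stake n (w @- \<theta>) = w"
          using w(2) by (simp add: stake_shift)
        ultimately show ?thesis
          using close[of "w @- \<theta>" b'] b' by auto
      qed
      moreover have "\<exists>x\<in>(IFS_operator I f ^^ n) B. dist y x < e" if y: "y \<in> ?A" for y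
      proof -
        obtain \<omega> where \<omega>: "\<omega> \<in> streams I" "y = canonical_projection f \<omega>"
          using y by blast
        have "word_map f (stake n \<omega>) b \<in> (IFS_operator I f ^^ n) B"
          using set_stake_subset[OF \<omega>(1)] b by (force simp: IFS_operator_funpow)
        then show ?thesis
          using close[OF \<omega>(1) b] \<omega>(2) by (metis dist_commute)
      qed
      ultimately show ?case by blast
    qed
  qed
  then show ?thesis
    by (subst hausdorff_tendsto_zero_iff[OF A]) blast
qed

lemma attractor_eq_canonical_projection_image:
  fixes f :: "'i \<Rightarrow> 'a::complete_space \<Rightarrow> 'a"
  assumes ifs: "convex_contraction_IFS I f"
  shows "attractor I f = canonical_projection f ` streams I"
  unfolding attractor_def
proof (rule the_equality, intro conjI ballI)
  let ?A = "canonical_projection f ` streams I"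
  show A: "?A \<in> nonempty_compacts"
    by (rule canonical_projection_image_nonempty_compact[OF ifs])
  show "(\<lambda>n. hausdorff_pompeiu ((IFS_operator I f ^^ n) B) ?A) \<longlonglongrightarrow> 0"
    if "B \<in> nonempty_compacts" for B
    using IFS_operator_iterates_tendsto[OF ifs that] .
  fix A' assume A': "A' \<in> nonempty_compacts \<and>
    (\<forall>B\<in>nonempty_compacts. (\<lambda>n. hausdorff_pompeiu ((IFS_operator I f ^^ n) B) A') \<longlonglongrightarrow> 0)"
  have lim: "(\<lambda>n. hausdorff_pompeiu ((IFS_operator I f ^^ n) ?A) ?A) \<longlonglongrightarrow> 0"
    "(\<lambda>n. hausdorff_pompeiu ((IFS_operator I f ^^ n) ?A) A') \<longlonglongrightarrow> 0"
    using IFS_operator_iterates_tendsto[OF ifs A] A A' by blast+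
  have "closed ?A" "?A \<noteq> {}" "closed A'" "A' \<noteq> {}"
    using A A' by (auto simp: nonempty_compacts_def compact_imp_closed)
  then show "A' = ?A"
    using lim by (intro equalityI hausdorff_limit_subset[where S = "\<lambda>n. (IFS_operator I f ^^ n) ?A"])
qed

theorem theorem3p6:
  fixes I :: "'i set" and f :: "'i \<Rightarrow> 'a::complete_space \<Rightarrow> 'a"
  assumes "convex_contraction_IFS I f"
  shows "continuous_map (Metric_space.mtopology (streams I) word_dist)
           (top_of_set (attractor I f)) (canonical_projection f) \<and>
         canonical_projection f ` streams I = attractor I f \<and>
         (\<forall>i\<in>I. \<forall>\<omega>\<in>streams I.
            (canonical_projection f \<circ> (##) i) \<omega> = (f i \<circ> canonical_projection f) \<omega>)"
proof (intro conjI ballI)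
  interpret W: Metric_space "streams I" word_dist
    by (rule Metric_space_word_dist)
  show eq: "canonical_projection f ` streams I = attractor I f"
    by (rule attractor_eq_canonical_projection_image[OF assms, symmetric])
  show "continuous_map W.mtopology (top_of_set (attractor I f)) (canonical_projection f)"
    using continuous_map_canonical_projection[OF assms] eq
    by (auto simp: continuous_map_in_subtopology)
  show "(canonical_projection f \<circ> (##) i) \<omega> = (f i \<circ> canonical_projection f) \<omega>"
    if "i \<in> I" "\<omega> \<in> streams I" for i \<omega>
    using canonical_projection_Stream[OF assms that] by simp
qed

end
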